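(* Let $p$ be a prime with $p\equiv 5\pmod{12}$. Then the permutation polynomial $D_{p+1}(1,x)$ of $\mathbb{F}_p$ has no fixed point in $\mathbb{F}_p$, i.e. there is no $c\in\mathbb{F}_p$ with $D_{p+1}(1,c)=c$.
   Context: The $n$th reversed Dickson polynomial of the first kind (with parameter $1$) is the integer-coefficient polynomial $D_n(1,x)$ defined by $D_0(1,x)=2$, $D_1(1,x)=1$, $D_n(1,x)=D_{n-1}(1,x)-x\,D_{n-2}(1,x)$ for $n\ge 2$ (equivalently, for $n\geq 1$, $D_n(1,x)=\sum_{i=0}^{\lfloor n/2\rfloor}\frac{n}{n-i}\binom{n-i}{i}(-x)^i$). Coefficients are reduced modulo $p$ to regard it as a polynomial over $\mathbb{F}_p$. A permutation polynomial of $\mathbb{F}_p$ is a polynomial whose associated map $\mathbb{F}_p\to\mathbb{F}_p$ is a bijection. *)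

theory Defs
  imports
    "HOL-Computational_Algebra.Polynomial"
    "HOL-Number_Theory.Cong"
    "Berlekamp_Zassenhaus.Finite_Field"
begin

text \<open>Reversed Dickson polynomials of the first kind with parameter \<open>1\<close>:
  \<open>reversed_dickson n\<close> is \<open>D\<^sub>n(1, x)\<close>; the polynomial \<open>[:0, 1:]\<close> is the indeterminate \<open>x\<close>.\<close>

fun reversed_dickson :: "nat \<Rightarrow> int poly" where
  "reversed_dickson 0 = [:2:]"
| "reversed_dickson (Suc 0) = [:1:]"
| "reversed_dickson (Suc (Suc n)) =
     reversed_dickson (Suc n) - [:0, 1:] * reversed_dickson n"

text \<open>For \<open>CARD('p)\<close> prime, \<open>'p mod_ring\<close> is the prime field with \<open>CARD('p)\<close> elements, and
  \<open>of_int\<close> is reduction modulo \<open>CARD('p)\<close>.\<close>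

definition reversed_dickson_mod :: "nat \<Rightarrow> 'p::prime_card mod_ring poly" where
  "reversed_dickson_mod n = map_poly of_int (reversed_dickson n)"

definition permutation_polynomial :: "'a::comm_semiring_0 poly \<Rightarrow> bool" where
  "permutation_polynomial f \<longleftrightarrow> bij (poly f)"

end

theory Submission
  imports Defs
begin

text \<open>
  Substituting \<open>x = y (1 - y)\<close> solves the recurrence: \<open>D\<^sub>n(1, y (1 - y)) = y\<^sup>n + (1 - y)\<^sup>n\<close>.  For
  \<open>n = p + 1\<close> in characteristic \<open>p\<close> the Frobenius map collapses the right-hand side to a polynomial
  in \<open>(1 - 2 y)\<^sup>2 = 1 - 4 x\<close>, which gives
  \<open>2 D\<^bsub>p+1\<^esub>(1, x) = 1 + u\<^bsup>(p+1)/2\<^esup>\<close> with \<open>u = 1 - 4 x\<close>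
  (\<open>two_times_reversed_dickson_mod_Suc_card\<close>).
  On the field with \<open>p\<close> elements the power \<open>u\<^bsup>(p-1)/2\<^esup>\<close> is the quadratic character
  \<open>\<eta>(u) \<in> {0, 1, -1}\<close> (\<open>power_half_card_mod_ring_cases\<close>), so in the coordinate \<open>u\<close> the map is essentially \<open>u \<mapsto> u \<eta>(u)\<close>.

  Since \<open>p \<equiv> 1 (mod 4)\<close>, the exponent \<open>(p - 1) / 2\<close> is even, so \<open>\<eta>(u \<eta>(u)) = \<eta>(u)\<close>.  Hence
  \<open>u \<eta>(u)\<close> determines \<open>\<eta>(u)\<close>, and with it \<open>u\<close>: the map is injective, and so bijective
  (\<open>inj_mult_power_half_card\<close>).

  A fixed point satisfies \<open>1 + u + 2 u \<eta>(u) = 0\<close>.  The value \<open>\<eta>(u) = 0\<close> is absurd, \<open>\<eta>(u) = -1\<close>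
  forces \<open>u = 1\<close>, which is a square, and \<open>\<eta>(u) = 1\<close> forces \<open>-3 u = 1\<close>, so that \<open>-3\<close> would be a
  square.  But \<open>\<eta>(-3) = -1\<close> because \<open>p \<equiv> 2 (mod 3)\<close>.  This too can be read off from the closed form,
  at \<open>x = 1\<close>, where \<open>u = -3\<close>: the sequence \<open>D\<^sub>n(1, 1)\<close> has period \<open>6\<close>, and \<open>6\<close> divides \<open>p + 1\<close>, so
  \<open>4 = 2 D\<^sub>0(1, 1) = 1 - 3 \<eta>(-3)\<close>.
\<close>

lemma reversed_dickson_mod_0 [simp]:
  "reversed_dickson_mod 0 = ([:2:] :: 'p::prime_card mod_ring poly)"
  by (simp add: reversed_dickson_mod_def)

lemma reversed_dickson_mod_1 [simp]:
  "reversed_dickson_mod (Suc 0) = (1 :: 'p::prime_card mod_ring poly)"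
  by (simp add: reversed_dickson_mod_def)

lemma reversed_dickson_mod_Suc_Suc [simp]:
  "reversed_dickson_mod (Suc (Suc n)) =
     reversed_dickson_mod (Suc n) - [:0, 1:] * (reversed_dickson_mod n :: 'p::prime_card mod_ring poly)"
  by (simp add: reversed_dickson_mod_def of_int_poly_hom.hom_minus of_int_poly_hom.hom_mult
      del: mult_pCons_left)

text \<open>
  Both \<open>y\<close> and \<open>1 - y\<close> are roots of \<open>t\<^sup>2 - t + y (1 - y)\<close>, the characteristic polynomial of the
  recurrence at \<open>x = y (1 - y)\<close>.  Taking \<open>y\<close> to be a polynomial avoids the quadratic extension in
  which a given \<open>x\<close> takes the form \<open>y (1 - y)\<close>.
\<close>

lemma pcompose_reversed_dickson_mod:
  fixes y :: "'p::prime_card mod_ring poly"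
  shows "pcompose (reversed_dickson_mod n) (y * (1 - y)) = y ^ n + (1 - y) ^ n"
proof (induction n rule: reversed_dickson.induct)
  case (3 n)
  then show ?case
    by (simp add: pcompose_diff pcompose_mult pcompose_pCons algebra_simps del: mult_pCons_left)
qed (simp_all add: pcompose_1 numeral_poly)

text \<open>
  The two sides agree after substituting \<open>Y (1 - Y)\<close>, where \<open>Y\<close> is the indeterminate, and
  composition with a non-constant polynomial is injective.  After the substitution \<open>1 - 4 x\<close> becomes
  the square of \<open>1 - 2 Y = (1 - Y) - Y\<close>, to which the Frobenius map applies term by term.
\<close>

lemma two_times_reversed_dickson_mod_Suc_card:
  assumes "odd CARD('p::prime_card)"
  shows "2 * reversed_dickson_mod (CARD('p) + 1) =
           (1 + [:1, -4:] ^ ((CARD('p) + 1) div 2) :: 'p mod_ring poly)"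
proof -
  define p where "p = CARD('p)"
  define Y :: "'p mod_ring poly" where "Y = [:0, 1:]"
  have frobenius: "(a + b) ^ p = a ^ p + b ^ p" for a b :: "'p mod_ring poly"
    using prime_card[where 'a = 'p] by (intro freshmans_dream) (simp_all add: p_def)
  have frobenius_diff: "(a - b) ^ p = a ^ p - b ^ p" for a b :: "'p mod_ring poly"
    using frobenius[of "a - b" b] by (simp add: algebra_simps)
  have 1: "(1 - Y) ^ p = 1 - Y ^ p"
    by (simp add: frobenius_diff)
  have 2: "(1 - Y - Y) ^ p = 1 - Y ^ p - Y ^ p"
    by (simp only: frobenius_diff power_one)
  have square: "pcompose [:1, -4:] (Y * (1 - Y)) = (1 - Y - Y)\<^sup>2"
    by (simp add: Y_def pcompose_pCons power2_eq_square one_pCons)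
  have half: "2 * ((p + 1) div 2) = p + 1"
    using assms by (simp add: p_def)
  have pow: "pcompose ([:1, -4:] ^ k) (Y * (1 - Y)) = (1 - Y - Y) ^ (2 * k)" for k
  proof (induction k)
    case (Suc k)
    have "2 * Suc k = 2 + 2 * k" by simp
    then show ?case by (simp only: power_Suc pcompose_mult Suc.IH square power_add)
  qed (simp add: pcompose_1)
  have expand: "2 * (z * a + (1 - z) * (1 - a)) = 1 + (1 - z - z) * (1 - a - a)"
    for a z :: "'p mod_ring poly"
    by (simp add: algebra_simps)
  have "pcompose (2 * reversed_dickson_mod (p + 1) - (1 + [:1, -4:] ^ ((p + 1) div 2))) (Y * (1 - Y))
      = 2 * (Y ^ (p + 1) + (1 - Y) ^ (p + 1)) - (1 + (1 - Y - Y) ^ (p + 1))"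
    unfolding mult_2[of "_ :: 'p mod_ring poly"] pcompose_diff pcompose_add pcompose_1 pow half
      pcompose_reversed_dickson_mod ..
  also have "\<dots> = 0"
    unfolding power_add power_one_right 1 2 expand by simp
  finally have "2 * reversed_dickson_mod (p + 1) - (1 + [:1, -4 :: 'p mod_ring:] ^ ((p + 1) div 2)) = 0"
    by (rule pcompose_eq_0) (simp add: Y_def one_pCons)
  then show ?thesis
    by (simp add: p_def)
qed

text \<open>
  At \<open>x = 1\<close> the characteristic polynomial \<open>t\<^sup>2 - t + 1\<close> divides \<open>t\<^sup>6 - 1\<close>, whence the period \<open>6\<close>.  As the
  recurrence has order two, the induction must carry two consecutive values.
\<close>

lemma poly_reversed_dickson_mod_1_multiple_6:
  "poly (reversed_dickson_mod (6 * k)) (1 :: 'p::prime_card mod_ring) = 2 \<and>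
   poly (reversed_dickson_mod (Suc (6 * k))) (1 :: 'p mod_ring) = 1"
proof (induction k)
  case (Suc k)
  have rec: "poly (reversed_dickson_mod (Suc (Suc n))) 1 =
      poly (reversed_dickson_mod (Suc n)) 1 - poly (reversed_dickson_mod n) (1 :: 'p mod_ring)" for n
    by simp
  have "6 * Suc k = Suc (Suc (Suc (Suc (Suc (Suc (6 * k))))))"
    by simp
  then show ?case
    using Suc.IH by (simp only: rec) simp
qed simp

text \<open>Fermat's little theorem makes \<open>u\<^bsup>(p-1)/2\<^esup>\<close> a root of \<open>e\<^sup>2 = 1\<close> when \<open>u \<noteq> 0\<close>.\<close>

lemma power_half_card_mod_ring_cases:
  fixes u :: "'p::prime_card mod_ring"
  assumes "odd CARD('p)"
  obtains "u ^ ((CARD('p) - 1) div 2) = 0" "u = 0"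
    | "u ^ ((CARD('p) - 1) div 2) = 1" | "u ^ ((CARD('p) - 1) div 2) = -1"
proof (cases "u = 0")
  case True
  have "CARD('p) \<noteq> 2" using assms by auto
  then have "(CARD('p) - 1) div 2 > 0"
    using prime_gt_1_nat[OF prime_card[where 'a = 'p]] by simp
  with True that show ?thesis by simp
next
  case False
  have card: "Suc ((CARD('p) - 1) div 2 * 2) = CARD('p)"
    using assms by (auto elim!: oddE)
  have "u * (u ^ ((CARD('p) - 1) div 2))\<^sup>2 = u ^ Suc ((CARD('p) - 1) div 2 * 2)"
    by (simp only: power_Suc power_mult)
  also have "\<dots> = u"
    unfolding card using finite_field_power_card_eq_same[of u] by simp
  finally have "(u ^ ((CARD('p) - 1) div 2))\<^sup>2 = 1"
    using False by simp
  then show ?thesis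
    using that by (auto simp: power2_eq_1_iff)
qed

text \<open>
  Let \<open>e = u\<^sup>m\<close>, where \<open>m = (p - 1) / 2\<close> is even.  As \<open>e \<in> {0, 1, -1}\<close>, the power \<open>(u e)\<^sup>m = e e\<^sup>m\<close> is
  again \<open>e\<close>, so \<open>u e\<close> determines \<open>e\<close> and then \<open>u\<close>.
\<close>

lemma inj_mult_power_half_card:
  assumes "[CARD('p::prime_card) = 1] (mod 4)"
  shows "inj (\<lambda>u :: 'p mod_ring. u * u ^ ((CARD('p) - 1) div 2))"
proof (rule injI)
  fix u v :: "'p mod_ring"
  define m where "m = (CARD('p) - 1) div 2"
  from assms have "CARD('p) mod 4 = 1" by (simp add: cong_def)
  then obtain k where k: "CARD('p) = 4 * k + 1" by (metis mult_div_mod_eq)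
  then have odd: "odd CARD('p)" and m: "even m" and "m > 0"
    using prime_gt_1_nat[OF prime_card[where 'a = 'p]] by (simp_all add: m_def)
  have idem: "(w * w ^ m) ^ m = w ^ m" for w :: "'p mod_ring"
    using power_half_card_mod_ring_cases[OF odd, of w, folded m_def]
    by cases (use m \<open>m > 0\<close> in \<open>auto simp: power_mult_distrib\<close>)
  assume "u * u ^ ((CARD('p) - 1) div 2) = v * v ^ ((CARD('p) - 1) div 2)"
  then have eq: "u * u ^ m = v * v ^ m" by (simp add: m_def)
  then have "u ^ m = v ^ m" using idem by metis
  with eq \<open>m > 0\<close> show "u = v" by (auto simp: power_0_left)
qed

lemma numeral_mod_ring_neq_0:
  assumes "numeral k < CARD('p::prime_card)"
  shows "(numeral k :: 'p mod_ring) \<noteq> 0"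
  using of_nat_0_mod_ring_dvd[of "numeral k", where 'a = 'p]
    nat_dvd_not_less[of "numeral k" "CARD('p)"] assms
  by auto

theorem theorem3p6:
  fixes p :: nat
  assumes "prime p" and "[p = 5] (mod 12)" and "CARD('p::prime_card) = p"
  shows "permutation_polynomial (reversed_dickson_mod (p + 1) :: 'p mod_ring poly) \<and>
         \<not> (\<exists>c :: 'p mod_ring. poly (reversed_dickson_mod (p + 1)) c = c)"
proof -
  define D :: "'p mod_ring poly" where "D = reversed_dickson_mod (p + 1)"
  define m where "m = (p - 1) div 2"
  have "p mod 12 = 5" using assms(2) by (simp add: cong_def)
  then obtain k where k: "p = 12 * k + 5" by (metis mult_div_mod_eq)
  then have odd: "odd CARD('p)" and "p \<ge> 5" and m: "(p + 1) div 2 = Suc m" and "p + 1 = 6 * (2 * k + 1)"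
    by (simp_all add: assms(3) m_def)
  have mod4: "[CARD('p) = 1] (mod 4)"
    unfolding assms(3) k cong_def by presburger
  have neq_0: "(2 :: 'p mod_ring) \<noteq> 0" "(3 :: 'p mod_ring) \<noteq> 0" "(4 :: 'p mod_ring) \<noteq> 0"
    using \<open>p \<ge> 5\<close> by (auto intro!: numeral_mod_ring_neq_0 simp: assms(3))
  have closed_form: "2 * poly D x = 1 + (1 - 4 * x) * (1 - 4 * x) ^ m" for x
  proof -
    have "2 * D = 1 + [:1, -4:] ^ Suc m"
      using two_times_reversed_dickson_mod_Suc_card[OF odd] by (simp only: D_def assms(3) m)
    then have "poly (2 * D) x = poly (1 + [:1, -4:] ^ Suc m) x"
      by (rule arg_cong)
    moreover have "poly [:1, -4:] x = 1 - 4 * x"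
      by simp
    ultimately show ?thesis
      by (simp only: poly_mult poly_add poly_1 poly_power poly_numeral power_Suc)
  qed

  have "inj (poly D)"
  proof (rule injI)
    fix x y assume "poly D x = poly D y"
    then have "1 + (1 - 4 * x) * (1 - 4 * x) ^ m = 1 + (1 - 4 * y) * (1 - 4 * y) ^ m"
      unfolding closed_form[symmetric] by (rule arg_cong)
    then have "(1 - 4 * x) * (1 - 4 * x) ^ m = (1 - 4 * y) * (1 - 4 * y) ^ m"
      by (rule add_left_imp_eq)
    then have "1 - 4 * x = 1 - 4 * y"
      unfolding m_def assms(3)[symmetric] by (rule injD[OF inj_mult_power_half_card[OF mod4]])
    then show "x = y" using neq_0 by simp
  qed
  then have perm: "permutation_polynomial D"
    by (simp add: permutation_polynomial_def bij_def finite_UNIV_inj_surj)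

  have minus_3: "(- 3 :: 'p mod_ring) ^ m = -1"
  proof -
    have "poly D 1 = 2"
      unfolding D_def \<open>p + 1 = 6 * (2 * k + 1)\<close>
      using poly_reversed_dickson_mod_1_multiple_6 by (rule conjunct1)
    then have "3 * ((- 3) ^ m + 1) = (0 :: 'p mod_ring)"
      using closed_form[of 1] by (simp add: algebra_simps)
    then have "(- 3) ^ m + 1 = (0 :: 'p mod_ring)"
      unfolding mult_eq_0_iff using neq_0 by blast
    then show ?thesis by (simp add: eq_neg_iff_add_eq_0)
  qed

  have "poly D c \<noteq> c" for c
  proof
    assume fixed: "poly D c = c"
    define u where "u = 1 - 4 * c"
    have "2 * c = 1 + u * u ^ m"
      using closed_form[of c] unfolding fixed u_def .
    moreover have "u = 1 - 2 * (2 * c)"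
      by (simp add: u_def)
    ultimately have "u = 1 - 2 * (1 + u * u ^ m)"
      by (simp only:)
    moreover have "1 + a + 2 * t = 0" if "a = 1 - 2 * (1 + t)" for a t :: "'p mod_ring"
      using that by simp
    ultimately have eq: "1 + u + 2 * (u * u ^ m) = 0"
      by blast
    show False
      using power_half_card_mod_ring_cases[OF odd, of u, unfolded assms(3), folded m_def]
    proof cases
      case 1
      with eq show False by simp
    next
      case 2
      with eq have "1 + 3 * u = 0" by (simp add: algebra_simps)
      then have "3 * u = -1" by (simp only: add_eq_0_iff)
      then have "(- 3) * u = 1" by simp
      then have "(- 3) ^ m * u ^ m = 1" by (metis power_mult_distrib power_one)
      with 2 minus_3 neq_0 show False by simp
    next
      case 3
      with eq have "1 - u = 0" by (simp add: algebra_simps)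
      then have "u = 1" by simp
      with 3 neq_0 show False by simp
    qed
  qed
  with perm show ?thesis by (simp add: D_def)
qed

end
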